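(* Let $G$ be a nontrivial finite group and let $C\subseteq G\setminus\{1\}$ be an inverse-closed generating set for $G$. (a) If $X$ is a normal $C$-closed generating set for $G$, then $X\setminus (X\cap \Phi(G;C))$ is also a normal $C$-closed generating set for $G$. (b) The subgroup $\Phi(G;C)$ is precisely the set of all elements $y\in G$ which satisfy the following property: for every subset $X\subseteq G$, if the normal $C$-closure of $X\cup\{y\}$ generates $G$, then the normal $C$-closure of $X$ also generates $G$.
   Context: A subset $C\subseteq G\setminus\{1\}$ is inverse-closed if it is non-empty and $c^{-1}\in C$ for each $c\in C$. $\mathrm{Aut}(G;C)=\{\sigma\in\mathrm{Aut}(G)\mid C^\sigma=C\}$, where maps are written as exponents. A subgroup $N\le G$ is $\mathrm{Aut}(G;C)$-invariant if $N^\sigma=N$ for all $\sigma\in\mathrm{Aut}(G;C)$. Define $\mathcal{A}(G;C)=\{N\mid N\unlhd G,\ N\neq G,\ N \text{ is } \mathrm{Aut}(G;C)\text{-invariant}\}$, let $\mathcal{A}_{\max}(G;C)$ be the set of elements of $\mathcal{A}(G;C)$ which are maximal with respect to inclusion, and let $\Phi(G;C)=\bigcap\{N\mid N\in\mathcal{A}_{\max}(G;C)\}$. A subset $X\subseteq G$ is normal $C$-closed if $(x^g)^\sigma\in X$ for all $x\in X$, $g\in G$, $\sigma\in\mathrm{Aut}(G;C)$, where $x^g=g^{-1}xg$. The normal $C$-closure of an arbitrary subset $X\subseteq G$ is the set $\{(x^g)^\sigma\mid x\in X,\ g\in G,\ \sigma\in\mathrm{Aut}(G;C)\}$. *)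

theory Defs
  imports "HOL-Algebra.Bij" "HOL-Algebra.Generated_Groups"
begin

definition inverse_closed :: "('a, 'b) monoid_scheme \<Rightarrow> 'a set \<Rightarrow> bool" where
  "inverse_closed G C \<longleftrightarrow>
     C \<subseteq> carrier G - {\<one>\<^bsub>G\<^esub>} \<and> C \<noteq> {} \<and> (\<forall>c\<in>C. inv\<^bsub>G\<^esub> c \<in> C)"

definition generates :: "('a, 'b) monoid_scheme \<Rightarrow> 'a set \<Rightarrow> bool" where
  "generates G X \<longleftrightarrow> X \<subseteq> carrier G \<and> generate G X = carrier G"

text \<open>Maps written as exponents in the literature are applied as functions here:
  the image of a set \<open>C\<close> under an automorphism \<open>\<sigma>\<close> is \<open>\<sigma> ` C\<close>. The library constant \<open>auto\<close>
  represents an automorphism by a function that is \<open>undefined\<close> outside the carrier.\<close>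

definition Aut_fix :: "('a, 'b) monoid_scheme \<Rightarrow> 'a set \<Rightarrow> ('a \<Rightarrow> 'a) set" where
  "Aut_fix G C = {\<sigma> \<in> auto G. \<sigma> ` C = C}"

definition Aut_invariant :: "('a, 'b) monoid_scheme \<Rightarrow> 'a set \<Rightarrow> 'a set \<Rightarrow> bool" where
  "Aut_invariant G C N \<longleftrightarrow> (\<forall>\<sigma>\<in>Aut_fix G C. \<sigma> ` N = N)"

definition inv_normals :: "('a, 'b) monoid_scheme \<Rightarrow> 'a set \<Rightarrow> 'a set set" where
  "inv_normals G C = {N. N \<lhd> G \<and> N \<noteq> carrier G \<and> Aut_invariant G C N}"

definition max_inv_normals :: "('a, 'b) monoid_scheme \<Rightarrow> 'a set \<Rightarrow> 'a set set" where
  "max_inv_normals G C =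
     {N \<in> inv_normals G C. \<forall>M\<in>inv_normals G C. N \<subseteq> M \<longrightarrow> M = N}"

text \<open>For a nontrivial finite group \<open>max_inv_normals G C\<close> is non-empty, because the trivial subgroup
  lies in \<open>inv_normals G C\<close>; the intersection is only meaningful in that case.\<close>

definition Phi :: "('a, 'b) monoid_scheme \<Rightarrow> 'a set \<Rightarrow> 'a set" where
  "Phi G C = \<Inter> (max_inv_normals G C)"

definition normal_C_closed :: "('a, 'b) monoid_scheme \<Rightarrow> 'a set \<Rightarrow> 'a set \<Rightarrow> bool" where
  "normal_C_closed G C X \<longleftrightarrow>
     X \<subseteq> carrier G \<and>
     (\<forall>x\<in>X. \<forall>g\<in>carrier G. \<forall>\<sigma>\<in>Aut_fix G C. \<sigma> (inv\<^bsub>G\<^esub> g \<otimes>\<^bsub>G\<^esub> x \<otimes>\<^bsub>G\<^esub> g) \<in> X)"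

definition normal_C_closure :: "('a, 'b) monoid_scheme \<Rightarrow> 'a set \<Rightarrow> 'a set \<Rightarrow> 'a set" where
  "normal_C_closure G C X =
     {\<sigma> (inv\<^bsub>G\<^esub> g \<otimes>\<^bsub>G\<^esub> x \<otimes>\<^bsub>G\<^esub> g) | x g \<sigma>. x \<in> X \<and> g \<in> carrier G \<and> \<sigma> \<in> Aut_fix G C}"

end

theory Submission
  imports Defs
begin

text \<open>As for the Frattini subgroup: a normal \<open>C\<close>-closed set generates a normal
  \<open>Aut(G;C)\<close>-invariant subgroup, so it either generates \<open>G\<close> or lies in a maximal member of
  \<open>\<A>(G;C)\<close>. Elements of \<open>\<Phi>(G;C)\<close> lie in every such maximal member, so they
  contribute nothing to generation. Conversely, if \<open>y\<close> is missing from a maximal member \<open>N\<close>, then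
  \<open>X = N\<close> violates the non-generator property of \<open>y\<close>.\<close>

context group
begin

section \<open>Automorphisms fixing C setwise\<close>

lemma Aut_fixD:
  assumes "\<sigma> \<in> Aut_fix G C"
  shows "\<sigma> \<in> hom G G" "\<sigma> \<in> extensional (carrier G)"
    "inj_on \<sigma> (carrier G)" "\<sigma> ` carrier G = carrier G" "\<sigma> ` C = C"
  using assms by (auto simp: Aut_fix_def auto_def Bij_def bij_betw_def)

lemma Aut_fix_closed: "\<sigma> \<in> Aut_fix G C \<Longrightarrow> x \<in> carrier G \<Longrightarrow> \<sigma> x \<in> carrier G"
  using Aut_fixD(4) by blast

lemma id_in_Aut_fix: "C \<subseteq> carrier G \<Longrightarrow> (\<lambda>x\<in>carrier G. x) \<in> Aut_fix G C"
  by (auto simp: Aut_fix_def id_in_auto image_iff subset_iff)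

text \<open>Lets two automorphisms applied in succession count as one. The restricted
  \<open>compose\<close> is used because members of \<open>auto G\<close> must be
  \<open>undefined\<close> off the carrier.\<close>

lemma compose_in_Aut_fix:
  assumes "C \<subseteq> carrier G" "\<sigma> \<in> Aut_fix G C" "\<tau> \<in> Aut_fix G C"
  shows "compose (carrier G) \<tau> \<sigma> \<in> Aut_fix G C"
proof -
  have "compose (carrier G) \<tau> \<sigma> \<in> auto G"
    using assms by (auto simp: Aut_fix_def auto_def compose_Bij hom_compose)
  moreover have "compose (carrier G) \<tau> \<sigma> ` C = \<tau> ` (\<sigma> ` C)"
    using assms(1) by (force simp: compose_def image_image)
  ultimately show ?thesis
    using Aut_fixD(5)[OF assms(2)] Aut_fixD(5)[OF assms(3)] by (simp add: Aut_fix_def)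
qed

section \<open>Membership in invariant normal subgroups\<close>

lemma normal_conj_iff:
  assumes "N \<lhd> G" "x \<in> carrier G" "g \<in> carrier G"
  shows "inv g \<otimes> x \<otimes> g \<in> N \<longleftrightarrow> x \<in> N"
proof
  assume "inv g \<otimes> x \<otimes> g \<in> N"
  then have "g \<otimes> (inv g \<otimes> x \<otimes> g) \<otimes> inv g \<in> N"
    using assms normal_invE(2) by blast
  moreover have "g \<otimes> (inv g \<otimes> x) = x"
    using assms(2,3) by (simp flip: m_assoc)
  ultimately show "x \<in> N"
    using assms(2,3) by (simp add: m_assoc)
next
  assume "x \<in> N"
  then show "inv g \<otimes> x \<otimes> g \<in> N"
    using assms(1,3) by (simp add: normal.inv_op_closed1)
qed

lemma invariant_conj_iff:
  assumes "N \<lhd> G" "Aut_invariant G C N" "x \<in> carrier G" "g \<in> carrier G" "\<sigma> \<in> Aut_fix G C"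
  shows "\<sigma> (inv g \<otimes> x \<otimes> g) \<in> N \<longleftrightarrow> x \<in> N"
proof -
  have "N \<subseteq> carrier G"
    using assms(1) normal_imp_subgroup subgroup.subset by blast
  moreover have "\<sigma> ` N = N"
    using assms(2,5) by (simp add: Aut_invariant_def)
  ultimately have "\<sigma> (inv g \<otimes> x \<otimes> g) \<in> N \<longleftrightarrow> inv g \<otimes> x \<otimes> g \<in> N"
    using inj_on_image_mem_iff[OF Aut_fixD(3)[OF assms(5)], of "inv g \<otimes> x \<otimes> g" N] assms(3,4)
    by simp
  then show ?thesis
    using normal_conj_iff assms(1,3,4) by simp
qed

section \<open>The normal C-closure\<close>

lemma normal_C_closure_subset:
  assumes "N \<lhd> G" "Aut_invariant G C N" "X \<subseteq> N"
  shows "normal_C_closure G C X \<subseteq> N"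
proof -
  have "N \<subseteq> carrier G"
    using assms(1) normal_imp_subgroup subgroup.subset by blast
  then show ?thesis
    using invariant_conj_iff[OF assms(1,2)] assms(3) by (auto simp: normal_C_closure_def subset_iff)
qed

lemma subset_normal_C_closure:
  assumes "C \<subseteq> carrier G" "X \<subseteq> carrier G"
  shows "X \<subseteq> normal_C_closure G C X"
proof
  fix x assume "x \<in> X"
  then have "x = (\<lambda>x\<in>carrier G. x) (inv \<one> \<otimes> x \<otimes> \<one>)"
    using assms(2) by auto
  then show "x \<in> normal_C_closure G C X"
    unfolding normal_C_closure_def using \<open>x \<in> X\<close> id_in_Aut_fix[OF assms(1)] by blast
qed

text \<open>By surjectivity the new conjugator h is \<sigma> k for some k, so conjugation by h moves
  inside \<sigma>. The two conjugations merge into one by \<open>g \<otimes> k\<close>, the two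
  automorphisms into \<tau> after \<sigma>.\<close>

lemma normal_C_closed_normal_C_closure:
  assumes "C \<subseteq> carrier G" "X \<subseteq> carrier G"
  shows "normal_C_closed G C (normal_C_closure G C X)"
  unfolding normal_C_closed_def
proof (intro conjI ballI)
  show "normal_C_closure G C X \<subseteq> carrier G"
  proof
    fix y assume "y \<in> normal_C_closure G C X"
    then obtain x g \<sigma> where "x \<in> X" "g \<in> carrier G" "\<sigma> \<in> Aut_fix G C"
      "y = \<sigma> (inv g \<otimes> x \<otimes> g)"
      by (auto simp: normal_C_closure_def)
    with assms(2) show "y \<in> carrier G"
      by (simp add: Aut_fix_closed subset_iff)
  qed
next
  fix y h \<tau>
  assume y: "y \<in> normal_C_closure G C X" and h: "h \<in> carrier G" and \<tau>: "\<tau> \<in> Aut_fix G C"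
  from y obtain x g \<sigma> where x: "x \<in> X" and g: "g \<in> carrier G" and \<sigma>: "\<sigma> \<in> Aut_fix G C"
    and y_eq: "y = \<sigma> (inv g \<otimes> x \<otimes> g)"
    by (auto simp: normal_C_closure_def)
  have xG: "x \<in> carrier G"
    using x assms(2) by blast
  obtain k where k: "k \<in> carrier G" "h = \<sigma> k"
    using h Aut_fixD(4)[OF \<sigma>] by blast
  interpret \<sigma>: group_hom G G \<sigma>
    using Aut_fixD(1)[OF \<sigma>] by unfold_locales
  have "inv h \<otimes> y \<otimes> h = \<sigma> (inv k \<otimes> (inv g \<otimes> x \<otimes> g) \<otimes> k)"
    using k g xG by (simp add: y_eq)
  also have "inv k \<otimes> (inv g \<otimes> x \<otimes> g) \<otimes> k = inv (g \<otimes> k) \<otimes> x \<otimes> (g \<otimes> k)"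
    using k g xG by (simp add: inv_mult_group m_assoc)
  finally have "\<tau> (inv h \<otimes> y \<otimes> h) =
      compose (carrier G) \<tau> \<sigma> (inv (g \<otimes> k) \<otimes> x \<otimes> (g \<otimes> k))"
    using k g xG by (simp add: compose_def)
  moreover have "g \<otimes> k \<in> carrier G"
    using g k by simp
  ultimately show "\<tau> (inv h \<otimes> y \<otimes> h) \<in> normal_C_closure G C X"
    unfolding normal_C_closure_def using x compose_in_Aut_fix[OF assms(1) \<sigma> \<tau>] by blast
qed

section \<open>Subgroups generated by normal C-closed sets\<close>

lemma normal_C_closed_conj:
  assumes "C \<subseteq> carrier G" "normal_C_closed G C X" "x \<in> X" "g \<in> carrier G"
  shows "g \<otimes> x \<otimes> inv g \<in> X"
proof -
  have "x \<in> carrier G"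
    using assms(2,3) by (auto simp: normal_C_closed_def)
  \<comment> \<open>Closedness speaks of \<open>inv g \<otimes> x \<otimes> g\<close>, while
    \<open>normal_generateI\<close> wants the opposite order, so \<open>inv g\<close> is the
    conjugator.\<close>
  moreover have "(\<lambda>x\<in>carrier G. x) (inv (inv g) \<otimes> x \<otimes> inv g) \<in> X"
    using assms(2-4) id_in_Aut_fix[OF assms(1)] inv_closed[OF assms(4)]
    unfolding normal_C_closed_def by blast
  ultimately show ?thesis
    using assms(4) by simp
qed

lemma normal_C_closed_image:
  assumes "finite (carrier G)" "normal_C_closed G C X" "\<sigma> \<in> Aut_fix G C"
  shows "\<sigma> ` X = X"
proof (rule endo_inj_surj)
  have XG: "X \<subseteq> carrier G"
    using assms(2) by (simp add: normal_C_closed_def)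
  then show "finite X" "inj_on \<sigma> X"
    using assms(1) Aut_fixD(3)[OF assms(3)] by (auto intro: finite_subset inj_on_subset)
  show "\<sigma> ` X \<subseteq> X"
  proof
    fix z assume "z \<in> \<sigma> ` X"
    then obtain x where "x \<in> X" "z = \<sigma> x" by blast
    moreover have "\<sigma> (inv \<one> \<otimes> x \<otimes> \<one>) \<in> X"
      using assms(2,3) \<open>x \<in> X\<close> one_closed unfolding normal_C_closed_def by blast
    ultimately show "z \<in> X"
      using XG by auto
  qed
qed

text \<open>Normality is inherited from the closure of X under conjugation. Invariance holds because
  a homomorphism maps \<open>generate G X\<close> onto the subgroup generated by the image of X,
  which is X again.\<close>

lemma generate_in_inv_normals:
  assumes "finite (carrier G)" "C \<subseteq> carrier G" "normal_C_closed G C X" "\<not> generates G X"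
  shows "generate G X \<in> inv_normals G C"
proof -
  have XG: "X \<subseteq> carrier G"
    using assms(3) by (simp add: normal_C_closed_def)
  have "generate G X \<lhd> G"
    using XG normal_C_closed_conj[OF assms(2,3)] by (rule normal_generateI)
  moreover have "generate G X \<noteq> carrier G"
    using XG assms(4) by (simp add: generates_def)
  moreover have "\<sigma> ` generate G X = generate G X" if \<sigma>: "\<sigma> \<in> Aut_fix G C" for \<sigma>
  proof -
    interpret \<sigma>: group_hom G G \<sigma>
      using Aut_fixD(1)[OF \<sigma>] by unfold_locales
    show ?thesis
      using \<sigma>.generate_img[OF XG] normal_C_closed_image[OF assms(1,3) \<sigma>] by simp
  qed
  ultimately show ?thesis
    by (simp add: inv_normals_def Aut_invariant_def)
qed

section \<open>Maximal invariant normal subgroups and generation\<close>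

lemma inv_normals_subset_max:
  assumes "finite (carrier G)" "N \<in> inv_normals G C"
  obtains M where "M \<in> max_inv_normals G C" "N \<subseteq> M"
proof -
  have "inv_normals G C \<subseteq> Pow (carrier G)"
    using subgroup.subset[OF normal_imp_subgroup] by (auto simp: inv_normals_def)
  then have "finite (inv_normals G C)"
    using assms(1) by (simp add: finite_subset)
  from finite_has_maximal2[OF this assms(2)]
  obtain M where "M \<in> inv_normals G C" "N \<subseteq> M" "\<forall>K\<in>inv_normals G C. M \<subseteq> K \<longrightarrow> M = K"
    by blast
  then show thesis
    using that[of M] by (auto simp: max_inv_normals_def)
qed

lemma max_inv_normalsD:
  assumes "N \<in> max_inv_normals G C"
  shows "N \<in> inv_normals G C" "N \<lhd> G" "N \<noteq> carrier G" "Aut_invariant G C N"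
    "subgroup N G" "N \<subseteq> carrier G"
proof -
  show N: "N \<in> inv_normals G C"
    using assms by (simp add: max_inv_normals_def)
  then show "N \<lhd> G" "N \<noteq> carrier G" "Aut_invariant G C N"
    by (auto simp: inv_normals_def)
  then show "subgroup N G" "N \<subseteq> carrier G"
    using normal_imp_subgroup subgroup.subset by blast+
qed

text \<open>Together with \<open>max_inv_normals_not_generates\<close>, this turns generation by a
  closed set into a question about containment in maximal members.\<close>

lemma normal_C_closed_not_generates:
  assumes "finite (carrier G)" "C \<subseteq> carrier G" "normal_C_closed G C X" "\<not> generates G X"
  obtains M where "M \<in> max_inv_normals G C" "X \<subseteq> M"
proof -
  obtain M where "M \<in> max_inv_normals G C" "generate G X \<subseteq> M"
    using inv_normals_subset_max[OF assms(1) generate_in_inv_normals[OF assms]] by blast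
  then show thesis
    using that[of M] generate.incl[of _ X G] by blast
qed

lemma max_inv_normals_not_generates:
  assumes "M \<in> max_inv_normals G C" "X \<subseteq> M"
  shows "\<not> generates G X"
proof
  assume "generates G X"
  then have "carrier G \<subseteq> M"
    using generate_subgroup_incl[OF assms(2) max_inv_normalsD(5)[OF assms(1)]]
    by (simp add: generates_def)
  then show False
    using max_inv_normalsD(3,6)[OF assms(1)] by blast
qed

section \<open>Removing \<open>Phi G C\<close> from a generating set\<close>

lemma normal_C_closed_Diff_Phi:
  assumes "normal_C_closed G C X"
  shows "normal_C_closed G C (X - (X \<inter> Phi G C))"
  unfolding normal_C_closed_def
proof (intro conjI ballI)
  show "X - (X \<inter> Phi G C) \<subseteq> carrier G"
    using assms by (auto simp: normal_C_closed_def)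
next
  fix x g \<sigma>
  assume x: "x \<in> X - (X \<inter> Phi G C)" and g: "g \<in> carrier G" and \<sigma>: "\<sigma> \<in> Aut_fix G C"
  then have "\<sigma> (inv g \<otimes> x \<otimes> g) \<in> X" and xG: "x \<in> carrier G"
    using assms by (auto simp: normal_C_closed_def)
  moreover have "\<sigma> (inv g \<otimes> x \<otimes> g) \<in> M \<longleftrightarrow> x \<in> M" if "M \<in> max_inv_normals G C" for M
    using invariant_conj_iff[OF max_inv_normalsD(2,4)[OF that] xG g \<sigma>] .
  ultimately show "\<sigma> (inv g \<otimes> x \<otimes> g) \<in> X - (X \<inter> Phi G C)"
    using x by (auto simp: Phi_def)
qed

lemma generates_Diff_Phi:
  assumes "finite (carrier G)" "C \<subseteq> carrier G" "normal_C_closed G C X" "generates G X"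
  shows "generates G (X - (X \<inter> Phi G C))"
proof (rule ccontr)
  assume "\<not> ?thesis"
  then obtain M where M: "M \<in> max_inv_normals G C" "X - (X \<inter> Phi G C) \<subseteq> M"
    using normal_C_closed_not_generates[OF assms(1,2) normal_C_closed_Diff_Phi[OF assms(3)]]
    by blast
  \<comment> \<open>The removed elements lie in \<open>Phi G C\<close>, hence in M as well.\<close>
  then have "X \<subseteq> M"
    by (auto simp: Phi_def)
  then show False
    using max_inv_normals_not_generates M(1) assms(4) by blast
qed

section \<open>\<open>Phi G C\<close> as the set of non-generators\<close>

text \<open>An intersection over an empty family would be \<open>UNIV\<close>, so a maximal member
  must be exhibited. The empty set is closed and generates only the trivial subgroup, which is
  proper, so some maximal member exists.\<close>

lemma Phi_subset_carrier:
  assumes "finite (carrier G)" "carrier G \<noteq> {\<one>}" "C \<subseteq> carrier G"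
  shows "Phi G C \<subseteq> carrier G"
proof -
  have "generate G {} = {\<one>}"
    by (rule generate_empty)
  then have "\<not> generates G {}"
    using assms(2) by (simp add: generates_def)
  then obtain M where "M \<in> max_inv_normals G C"
    using normal_C_closed_not_generates[OF assms(1,3), of "{}"]
    by (auto simp: normal_C_closed_def)
  then show ?thesis
    using max_inv_normalsD(6) by (auto simp: Phi_def)
qed

text \<open>A maximal M containing the closure of X also contains y, hence the closure of
  \<open>X \<union> {y}\<close>, which therefore cannot generate.\<close>

lemma Phi_nongenerator:
  assumes "finite (carrier G)" "C \<subseteq> carrier G" "X \<subseteq> carrier G" "y \<in> Phi G C"
    and "generates G (normal_C_closure G C (X \<union> {y}))"
  shows "generates G (normal_C_closure G C X)"
proof (rule ccontr)
  assume "\<not> ?thesis"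
  then obtain M where M: "M \<in> max_inv_normals G C" "normal_C_closure G C X \<subseteq> M"
    using normal_C_closed_not_generates[OF assms(1,2)]
      normal_C_closed_normal_C_closure[OF assms(2,3)] by blast
  then have "X \<union> {y} \<subseteq> M"
    using subset_normal_C_closure[OF assms(2,3)] assms(4) by (auto simp: Phi_def)
  then have "normal_C_closure G C (X \<union> {y}) \<subseteq> M"
    using normal_C_closure_subset max_inv_normalsD(2,4)[OF M(1)] by blast
  then show False
    using max_inv_normals_not_generates M(1) assms(5) by blast
qed

lemma nongenerator_in_Phi:
  assumes "finite (carrier G)" "C \<subseteq> carrier G" "y \<in> carrier G"
    and nongen: "\<And>X. X \<subseteq> carrier G \<Longrightarrow> generates G (normal_C_closure G C (X \<union> {y})) \<Longrightarrow>
      generates G (normal_C_closure G C X)"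
  shows "y \<in> Phi G C"
  unfolding Phi_def
proof (rule InterI, rule ccontr)
  fix N assume N: "N \<in> max_inv_normals G C" and y: "y \<notin> N"
  note NG = max_inv_normalsD[OF N]
  have sub: "N \<union> {y} \<subseteq> carrier G"
    using NG(6) assms(3) by blast
  \<comment> \<open>The test set is N itself: its closure stays inside N, so by the contrapositive
    of \<open>nongen\<close> adding y does not help either.\<close>
  have "\<not> generates G (normal_C_closure G C N)"
    using max_inv_normals_not_generates[OF N] normal_C_closure_subset[OF NG(2,4)] by blast
  then have "\<not> generates G (normal_C_closure G C (N \<union> {y}))"
    using nongen NG(6) by blast
  then obtain M where M: "M \<in> max_inv_normals G C" "normal_C_closure G C (N \<union> {y}) \<subseteq> M"
    using normal_C_closed_not_generates[OF assms(1,2)]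
      normal_C_closed_normal_C_closure[OF assms(2) sub] by blast
  then have "N \<union> {y} \<subseteq> M"
    using subset_normal_C_closure[OF assms(2) sub] by blast
  \<comment> \<open>Maximality of N, applied to the proper invariant normal subgroup M above it;
    this forces y into N.\<close>
  moreover have "M = N"
    using N calculation max_inv_normalsD(1)[OF M(1)] by (auto simp: max_inv_normals_def)
  ultimately show False
    using y by blast
qed

end

theorem theorem1p1:
  fixes G (structure) and C :: "'a set"
  assumes "group G" and "finite (carrier G)" and "carrier G \<noteq> {\<one>}"
    and "inverse_closed G C" and "generates G C"
  shows "(\<forall>X. normal_C_closed G C X \<and> generates G X \<longrightarrow>
             normal_C_closed G C (X - (X \<inter> Phi G C)) \<and> generates G (X - (X \<inter> Phi G C)))
       \<and> Phi G C =
           {y \<in> carrier G. \<forall>X \<subseteq> carrier G.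
              generates G (normal_C_closure G C (X \<union> {y})) \<longrightarrow>
              generates G (normal_C_closure G C X)}"
proof -
  interpret group G by fact
  have C: "C \<subseteq> carrier G"
    using assms(5) by (simp add: generates_def)
  show ?thesis
  proof (intro conjI allI impI)
    fix X assume X: "normal_C_closed G C X \<and> generates G X"
    then show "normal_C_closed G C (X - (X \<inter> Phi G C))"
      using normal_C_closed_Diff_Phi by blast
    show "generates G (X - (X \<inter> Phi G C))"
      using generates_Diff_Phi[OF assms(2) C] X by blast
  next
    show "Phi G C = {y \<in> carrier G. \<forall>X \<subseteq> carrier G.
        generates G (normal_C_closure G C (X \<union> {y})) \<longrightarrow>
        generates G (normal_C_closure G C X)}" (is "_ = ?R")
    proof
      \<comment> \<open>Membership in \<open>?R\<close> includes lying in the carrier, which is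
        where the nontriviality of G enters.\<close>
      show "Phi G C \<subseteq> ?R"
        using Phi_subset_carrier[OF assms(2,3) C] Phi_nongenerator[OF assms(2) C] by blast
      show "?R \<subseteq> Phi G C"
        using nongenerator_in_Phi[OF assms(2) C] by blast
    qed
  qed
qed

end
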